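(* Let $m\geq t\geq 3$ be integers and suppose $mt\equiv 0$ or $3\pmod 4$. Then there exists a signed magic array $SMA(m,2m;2t,t)$.
   Context: For positive integers $m,n,s,t$, a signed magic array $SMA(m,n;s,t)$ is an $m\times n$ array ($m$ rows, $n$ columns), some of whose cells may be empty, with entries from the set $X$, where $X=\{0,\pm1,\pm2,\ldots,\pm (ms-1)/2\}$ if $ms$ is odd and $X=\{\pm1,\pm2,\ldots,\pm ms/2\}$ if $ms$ is even, such that precisely $s$ cells in every row and precisely $t$ cells in every column are filled, every integer in $X$ appears exactly once in the array, and the sum of each row and of each column is zero. *)

theory Defs
  imports Main
begin

definition sma_entries :: "nat \<Rightarrow> nat \<Rightarrow> int set" where
  "sma_entries m s =
     (if odd (m * s) then {- ((int (m * s) - 1) div 2) .. (int (m * s) - 1) div 2}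
      else {- (int (m * s) div 2) .. int (m * s) div 2} - {0})"

text \<open>A partially filled array is a function into \<open>int option\<close>, with \<open>None\<close> for an empty cell.
  Rows are indexed by \<open>i < m\<close> and columns by \<open>j < n\<close>; values outside this range are irrelevant.\<close>

definition signed_magic_array ::
  "nat \<Rightarrow> nat \<Rightarrow> nat \<Rightarrow> nat \<Rightarrow> (nat \<Rightarrow> nat \<Rightarrow> int option) \<Rightarrow> bool" where
  "signed_magic_array m n s t A \<longleftrightarrow>
     0 < m \<and> 0 < n \<and> 0 < s \<and> 0 < t \<and>
     (\<forall>i<m. \<forall>j<n. \<forall>x. A i j = Some x \<longrightarrow> x \<in> sma_entries m s) \<and>
     (\<forall>i<m. card {j. j < n \<and> A i j \<noteq> None} = s) \<and>
     (\<forall>j<n. card {i. i < m \<and> A i j \<noteq> None} = t) \<and>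
     (\<forall>x\<in>sma_entries m s. \<exists>!(i, j). i < m \<and> j < n \<and> A i j = Some x) \<and>
     (\<forall>i<m. (\<Sum>j | j < n \<and> A i j \<noteq> None. the (A i j)) = 0) \<and>
     (\<forall>j<n. (\<Sum>i | i < m \<and> A i j \<noteq> None. the (A i j)) = 0)"

end

theory Submission
  imports Defs
begin

text \<open>
  Suppose that the numbers \<open>1, \<dots>, mt\<close> can be given signs and split into \<open>m\<close> columns of \<open>t\<close>
  numbers with sum zero. Place column \<open>j\<close> on \<open>t\<close> cyclically consecutive rows, so that each row is also
  met \<open>t\<close> times, and let \<open>H\<close> be the resulting square array. Then \<open>[H, -H]\<close> is a signed magic array:
  its row sums vanish by cancellation, whatever the row sums of \<open>H\<close> are.

  Four consecutive numbers satisfy \<open>(b+1) - (b+2) - (b+3) + (b+4) = 0\<close>, so \<open>t\<close> can be raised by 4,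
  and only \<open>t = 0, 3, 5, 6\<close> are left. For \<open>t = 6\<close> (and \<open>m\<close> even) twelve consecutive numbers split
  into two zero-sum sextuples. For \<open>t = 3\<close> a Skolem sequence, that is, a partition of \<open>{1..2m}\<close> into
  pairs \<open>(x\<^sub>d, x\<^sub>d + d)\<close> with \<open>d = 1, \<dots>, m\<close>, gives the columns \<open>d, m + x\<^sub>d, -(m + x\<^sub>d + d)\<close>. For \<open>t = 5\<close>
  a Langford sequence, with pairs \<open>(x\<^sub>d, x\<^sub>d + d + 1)\<close>, gives triples of sum \<open>-1\<close>, to be completed by
  two consecutive numbers of opposite signs.
\<close>

section \<open>Skolem and Langford sequences\<close>

text \<open>The \<open>2m\<close> positions are covered by \<open>m\<close> pairs, so no position is covered twice: disjointness and
  bounds need not be required.\<close>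

definition covering_pairs :: "nat \<Rightarrow> nat \<Rightarrow> (nat \<Rightarrow> nat) \<Rightarrow> bool" where
  "covering_pairs e m a \<longleftrightarrow>
     (\<forall>n\<in>{1..2 * m}. \<exists>d\<in>{1..m}. n = a d \<or> n = a d + d + e)"

text \<open>The explicit solutions are given by separate formulas for \<open>d = 2 * h\<close> and
  \<open>d = 2 * h + 1\<close>. Only the odd case admits \<open>h = 0\<close>, which is the pair of
  \<open>d = 1\<close>.\<close>

lemma covering_pairsI:
  assumes "\<And>n. 1 \<le> n \<Longrightarrow> n \<le> 2 * m \<Longrightarrow>
    \<exists>h. (1 \<le> h \<and> 2 * h \<le> m \<and> (n = E h \<or> n = E h + 2 * h + e)) \<or>
        (2 * h + 1 \<le> m \<and> (n = O' h \<or> n = O' h + (2 * h + 1) + e))"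
  shows "\<exists>a. covering_pairs e m a"
proof -
  define a where "a d = (if even d then E (d div 2) else O' (d div 2))" for d
  have a: "a (2 * h) = E h" "a (2 * h + 1) = O' h" for h
    by (simp_all add: a_def)
  have "covering_pairs e m a"
    unfolding covering_pairs_def
  proof
    fix n assume "n \<in> {1..2 * m}"
    then obtain h where "(1 \<le> h \<and> 2 * h \<le> m \<and> (n = E h \<or> n = E h + 2 * h + e)) \<or>
        (2 * h + 1 \<le> m \<and> (n = O' h \<or> n = O' h + (2 * h + 1) + e))"
      using assms[of n] by auto
    then show "\<exists>d\<in>{1..m}. n = a d \<or> n = a d + d + e"
    proof (elim disjE[of "_ \<and> _"])
      assume "1 \<le> h \<and> 2 * h \<le> m \<and> (n = E h \<or> n = E h + 2 * h + e)"
      then show ?thesis by (intro bexI[of _ "2 * h"]) (auto simp: a)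
    next
      assume "2 * h + 1 \<le> m \<and> (n = O' h \<or> n = O' h + (2 * h + 1) + e)"
      then show ?thesis by (intro bexI[of _ "2 * h + 1"]) (auto simp only: a atLeastAtMost_iff)
    qed
  qed
  then show ?thesis by blast
qed

section \<open>Explicit Skolem sequences\<close>

text \<open>In the next lemmas \<open>E h\<close> and \<open>O' h\<close> are the first positions of the pairs with \<open>d = 2h\<close> and
  \<open>d = 2h + 1\<close>. The values are those of the classical explicit solutions, the Langford ones due to Davies.\<close>

lemma skolem_pairs_mod_0:
  assumes "s \<ge> 1"
  shows "\<exists>a. covering_pairs 0 (4 * s) a"
proof -
  \<comment> \<open>The even differences form nested pairs around the centre \<open>6 * s\<close>.
    The odd ones form two nested families, with coordinate sums \<open>4 * s - 1\<close> and
    \<open>4 * s + 1\<close>; the pairs of the differences \<open>1\<close>,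
    \<open>2 * s - 1\<close> and \<open>4 * s - 1\<close> fill the gaps.\<close>
  define E where "E h = 6 * s - h" for h
  define O' where "O' h = (if h = 0 then s else if h + 1 = s then 2 * s
    else if h + 1 = 2 * s then 2 * s + 1 else if s \<le> h then 2 * s - 1 - h else 2 * s - h)" for h
  show ?thesis
  proof (rule covering_pairsI[where E = E and O' = O'])
    fix n assume n: "1 \<le> n" "n \<le> 2 * (4 * s)"
    \<comment> \<open>Two branches repeat an earlier lower bound. They use the pair with
      \<open>h = s - 1\<close>; for \<open>s = 1\<close> this index is \<open>0\<close>, where
      \<open>O'\<close> has another value, and the extra bound makes both branches empty.\<close>
    consider "n < s"
      | "s \<le> n \<and> n < s + 1"
      | "s + 1 \<le> n \<and> n < s + 2"
      | "s + 2 \<le> n \<and> n < 2 * s"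
      | "2 * s \<le> n \<and> n < 2 * s + 1 \<and> s + 2 \<le> n"
      | "2 * s + 1 \<le> n \<and> n < 2 * s + 2"
      | "2 * s + 2 \<le> n \<and> n < 3 * s"
      | "3 * s \<le> n \<and> n < 4 * s - 1"
      | "4 * s - 1 \<le> n \<and> n < 4 * s \<and> 2 * s + 2 \<le> n"
      | "4 * s \<le> n \<and> n < 6 * s"
      | "6 * s \<le> n \<and> n < 6 * s + 1"
      | "6 * s + 1 \<le> n"
      by (meson not_less)
    then show "\<exists>h. (1 \<le> h \<and> 2 * h \<le> 4 * s \<and> (n = E h \<or> n = E h + 2 * h + 0)) \<or>
      (2 * h + 1 \<le> 4 * s \<and> (n = O' h \<or> n = O' h + (2 * h + 1) + 0))"
    proof cases
      case 1
      with n assms show ?thesis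
        by (intro exI[of _ "2 * s - 1 - n"] disjI2 conjI disjI1) (auto simp: O'_def)
    next
      case 2
      with n assms show ?thesis
        by (intro exI[of _ "0"] disjI2 conjI disjI1) (auto simp: O'_def)
    next
      case 3
      with n assms show ?thesis
        by (intro exI[of _ "0"] disjI2 conjI disjI2) (auto simp: O'_def)
    next
      case 4
      with n assms show ?thesis
        by (intro exI[of _ "2 * s - n"] disjI2 conjI disjI1) (auto simp: O'_def)
    next
      case 5
      with n assms show ?thesis
        by (intro exI[of _ "s - 1"] disjI2 conjI disjI1) (auto simp: O'_def)
    next
      case 6
      with n assms show ?thesis
        by (intro exI[of _ "2 * s - 1"] disjI2 conjI disjI1) (auto simp: O'_def)
    next
      case 7
      with n assms show ?thesis
        by (intro exI[of _ "n - 2 * s - 1"] disjI2 conjI disjI2) (auto simp: O'_def)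
    next
      case 8
      with n assms show ?thesis
        by (intro exI[of _ "n - 2 * s"] disjI2 conjI disjI2) (auto simp: O'_def)
    next
      case 9
      with n assms show ?thesis
        by (intro exI[of _ "s - 1"] disjI2 conjI disjI2) (auto simp: O'_def)
    next
      case 10
      with n assms show ?thesis
        by (intro exI[of _ "6 * s - n"] disjI1 conjI disjI1) (auto simp: E_def)
    next
      case 11
      with n assms show ?thesis
        by (intro exI[of _ "2 * s - 1"] disjI2 conjI disjI2) (auto simp: O'_def)
    next
      case 12
      with n assms show ?thesis
        by (intro exI[of _ "n - 6 * s"] disjI1 conjI disjI2) (auto simp: E_def)
    qed
  qed
qed

lemma skolem_pairs_mod_1:
  assumes s: "s \<ge> 1"
  shows "\<exists>a. covering_pairs 0 (4 * s + 1) a"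
proof (cases "s = 1")
  case True
  \<comment> \<open>For \<open>s = 1\<close> the differences \<open>1\<close> and
    \<open>2 * s - 1\<close> of the general formulas coincide, so order 5 gets its own solution:
    (1,2), (7,9), (3,6), (4,8), (5,10).\<close>
  define a :: "nat \<Rightarrow> nat" where "a d = (if d = 1 then 1 else if d = 2 then 7 else d)" for d
  have "covering_pairs 0 5 a"
    unfolding covering_pairs_def a_def by code_simp
  with True show ?thesis by auto
next
  case False
  \<comment> \<open>Same pattern as for order \<open>4 * s\<close>: the centre is
    \<open>6 * s + 2\<close>, the odd families have coordinate sums \<open>4 * s + 1\<close> and
    \<open>4 * s + 3\<close>, and the single pairs have differences \<open>1\<close>,
    \<open>2 * s - 1\<close> and \<open>4 * s + 1\<close>.\<close>
  define E where "E h = 6 * s + 2 - h" for h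
  define O' where "O' h = (if h = 0 then s + 1 else if h + 1 = s then 2 * s + 2 else if h = 2 * s then 2 * s + 1
    else if s \<le> h then 2 * s - h else 2 * s + 1 - h)" for h
  show ?thesis
  proof (rule covering_pairsI[where E = E and O' = O'])
    fix n assume n: "1 \<le> n" "n \<le> 2 * (4 * s + 1)"
    consider "n < s + 1"
      | "s + 1 \<le> n \<and> n < s + 2"
      | "s + 2 \<le> n \<and> n < s + 3"
      | "s + 3 \<le> n \<and> n < 2 * s + 1"
      | "2 * s + 1 \<le> n \<and> n < 2 * s + 2"
      | "2 * s + 2 \<le> n \<and> n < 2 * s + 3"
      | "2 * s + 3 \<le> n \<and> n < 3 * s + 1"
      | "3 * s + 1 \<le> n \<and> n < 4 * s + 1"
      | "4 * s + 1 \<le> n \<and> n < 4 * s + 2"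
      | "4 * s + 2 \<le> n \<and> n < 6 * s + 2"
      | "6 * s + 2 \<le> n \<and> n < 6 * s + 3"
      | "6 * s + 3 \<le> n"
      by (meson not_less)
    then show "\<exists>h. (1 \<le> h \<and> 2 * h \<le> 4 * s + 1 \<and> (n = E h \<or> n = E h + 2 * h + 0)) \<or>
      (2 * h + 1 \<le> 4 * s + 1 \<and> (n = O' h \<or> n = O' h + (2 * h + 1) + 0))"
    proof cases
      case 1
      with n False s show ?thesis
        by (intro exI[of _ "2 * s - n"] disjI2 conjI disjI1) (auto simp: O'_def)
    next
      case 2
      with n False s show ?thesis
        by (intro exI[of _ "0"] disjI2 conjI disjI1) (auto simp: O'_def)
    next
      case 3
      with n False s show ?thesis
        by (intro exI[of _ "0"] disjI2 conjI disjI2) (auto simp: O'_def)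
    next
      case 4
      with n False s show ?thesis
        by (intro exI[of _ "2 * s + 1 - n"] disjI2 conjI disjI1) (auto simp: O'_def)
    next
      case 5
      with n False s show ?thesis
        by (intro exI[of _ "2 * s"] disjI2 conjI disjI1) (auto simp: O'_def)
    next
      case 6
      with n False s show ?thesis
        by (intro exI[of _ "s - 1"] disjI2 conjI disjI1) (auto simp: O'_def)
    next
      case 7
      with n False s show ?thesis
        by (intro exI[of _ "n - 2 * s - 2"] disjI2 conjI disjI2) (auto simp: O'_def)
    next
      case 8
      with n False s show ?thesis
        by (intro exI[of _ "n - 2 * s - 1"] disjI2 conjI disjI2) (auto simp: O'_def)
    next
      case 9
      with n False s show ?thesis
        by (intro exI[of _ "s - 1"] disjI2 conjI disjI2) (auto simp: O'_def)
    next
      case 10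
      with n False s show ?thesis
        by (intro exI[of _ "6 * s + 2 - n"] disjI1 conjI disjI1) (auto simp: E_def)
    next
      case 11
      with n False s show ?thesis
        by (intro exI[of _ "2 * s"] disjI2 conjI disjI2) (auto simp: O'_def)
    next
      case 12
      with n False s show ?thesis
        by (intro exI[of _ "n - 6 * s - 2"] disjI1 conjI disjI2) (auto simp: E_def)
    qed
  qed
qed

section \<open>Explicit Langford sequences with differences from 2 on\<close>

lemma langford_pairs_mod_0:
  assumes "x \<ge> 1"
  shows "\<exists>a. covering_pairs 1 (4 * x) a"
proof -
  \<comment> \<open>Each parity contributes two nested families, one around \<open>2 * x\<close> and
    one around \<open>6 * x\<close>, and two single pairs that fill the gaps. The distances are
    \<open>d + 1\<close>, hence odd for \<open>E\<close> and even for \<open>O'\<close>.\<close>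
  define E where "E h = (if h + 1 = 2 * x then x else if h = 2 * x then 4 * x - 1 else
    if h < x then 6 * x - 1 - h else 2 * x - 1 - h)" for h
  define O' where "O' h = (if h + 1 = x then 6 * x - 1 else if h + 1 = 2 * x then 2 * x
    else if h < x then 2 * x - 1 - h else 6 * x - 2 - h)" for h
  obtain y where y: "x = Suc y"
    using assms by (cases x) auto
  show ?thesis
  proof (rule covering_pairsI[where E = E and O' = O'])
    fix n assume n: "1 \<le> n" "n \<le> 2 * (4 * x)"
    consider "n < x"
      | "x \<le> n \<and> n < x + 1"
      | "x + 1 \<le> n \<and> n < 2 * x"
      | "2 * x \<le> n \<and> n < 2 * x + 1"
      | "2 * x + 1 \<le> n \<and> n < 3 * x"
      | "3 * x \<le> n \<and> n < 4 * x - 1"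
      | "4 * x - 1 \<le> n \<and> n < 4 * x"
      | "4 * x \<le> n \<and> n < 5 * x - 1"
      | "5 * x - 1 \<le> n \<and> n < 5 * x"
      | "5 * x \<le> n \<and> n < 6 * x - 1"
      | "6 * x - 1 \<le> n \<and> n < 6 * x"
      | "6 * x \<le> n \<and> n < 6 * x + 1"
      | "6 * x + 1 \<le> n \<and> n < 7 * x"
      | "7 * x \<le> n \<and> n < 8 * x - 1"
      | "8 * x - 1 \<le> n \<and> n < 8 * x"
      | "8 * x \<le> n"
      by (meson not_less)
    then show "\<exists>h. (1 \<le> h \<and> 2 * h \<le> 4 * x \<and> (n = E h \<or> n = E h + 2 * h + 1)) \<or>
      (2 * h + 1 \<le> 4 * x \<and> (n = O' h \<or> n = O' h + (2 * h + 1) + 1))"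
    proof cases
      case 1
      with n assms show ?thesis
        by (intro exI[of _ "2 * x - 1 - n"] disjI1 conjI disjI1) (auto simp: E_def)
    next
      case 2
      with n assms show ?thesis
        by (intro exI[of _ "2 * x - 1"] disjI1 conjI disjI1) (auto simp: E_def)
    next
      case 3
      with n assms show ?thesis
        by (intro exI[of _ "2 * x - 1 - n"] disjI2 conjI disjI1) (auto simp: O'_def)
    next
      case 4
      with n assms show ?thesis
        by (intro exI[of _ "2 * x - 1"] disjI2 conjI disjI1) (auto simp: O'_def)
    next
      case 5
      with n assms show ?thesis
        by (intro exI[of _ "n - 2 * x - 1"] disjI2 conjI disjI2) (auto simp: O'_def)
    next
      case 6
      with n assms show ?thesis
        by (intro exI[of _ "n - 2 * x"] disjI1 conjI disjI2) (auto simp: E_def)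
    next
      case 7
      with n assms show ?thesis
        by (intro exI[of _ "2 * x"] disjI1 conjI disjI1) (auto simp: E_def)
    next
      case 8
      with n assms show ?thesis
        by (intro exI[of _ "6 * x - 2 - n"] disjI2 conjI disjI1) (auto simp: O'_def)
    next
      case 9
      with n assms show ?thesis
        by (intro exI[of _ "2 * x - 1"] disjI1 conjI disjI2) (auto simp: E_def y)
    next
      case 10
      with n assms show ?thesis
        by (intro exI[of _ "6 * x - 1 - n"] disjI1 conjI disjI1) (auto simp: E_def)
    next
      case 11
      with n assms show ?thesis
        by (intro exI[of _ "x - 1"] disjI2 conjI disjI1) (auto simp: O'_def)
    next
      case 12
      with n assms show ?thesis
        by (intro exI[of _ "2 * x - 1"] disjI2 conjI disjI2) (auto simp: O'_def)
    next
      case 13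
      with n assms show ?thesis
        by (intro exI[of _ "n - 6 * x"] disjI1 conjI disjI2) (auto simp: E_def)
    next
      case 14
      with n assms show ?thesis
        by (intro exI[of _ "n - 6 * x"] disjI2 conjI disjI2) (auto simp: O'_def)
    next
      case 15
      with n assms show ?thesis
        by (intro exI[of _ "x - 1"] disjI2 conjI disjI2) (auto simp: O'_def)
    next
      case 16
      with n assms show ?thesis
        by (intro exI[of _ "2 * x"] disjI1 conjI disjI2) (auto simp: E_def)
    qed
  qed
qed

text \<open>Arises from the solution of order \<open>4 * x\<close>: the longest pair
  \<open>(4 * x - 1, 8 * x)\<close> is dropped, and \<open>(6 * x - 1, 8 * x - 1)\<close> is
  replaced by \<open>(4 * x - 1, 6 * x - 1)\<close>, also at distance \<open>2 * x\<close>. This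
  frees exactly the last two positions.\<close>

lemma langford_pairs_mod_3:
  assumes "x \<ge> 1"
  shows "\<exists>a. covering_pairs 1 (4 * x - 1) a"
proof -
  define E where "E h = (if h + 1 = 2 * x then x else
    if h < x then 6 * x - 1 - h else 2 * x - 1 - h)" for h
  define O' where "O' h = (if h + 1 = x then 4 * x - 1 else if h + 1 = 2 * x then 2 * x
    else if h < x then 2 * x - 1 - h else 6 * x - 2 - h)" for h
  obtain y where y: "x = Suc y"
    using assms by (cases x) auto
  show ?thesis
  proof (rule covering_pairsI[where E = E and O' = O'])
    fix n assume n: "1 \<le> n" "n \<le> 2 * (4 * x - 1)"
    consider "n < x"
      | "x \<le> n \<and> n < x + 1"
      | "x + 1 \<le> n \<and> n < 2 * x"
      | "2 * x \<le> n \<and> n < 2 * x + 1"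
      | "2 * x + 1 \<le> n \<and> n < 3 * x"
      | "3 * x \<le> n \<and> n < 4 * x - 1"
      | "4 * x - 1 \<le> n \<and> n < 4 * x"
      | "4 * x \<le> n \<and> n < 5 * x - 1"
      | "5 * x - 1 \<le> n \<and> n < 5 * x"
      | "5 * x \<le> n \<and> n < 6 * x - 1"
      | "6 * x - 1 \<le> n \<and> n < 6 * x"
      | "6 * x \<le> n \<and> n < 6 * x + 1"
      | "6 * x + 1 \<le> n \<and> n < 7 * x"
      | "7 * x \<le> n"
      by (meson not_less)
    then show "\<exists>h. (1 \<le> h \<and> 2 * h \<le> 4 * x - 1 \<and> (n = E h \<or> n = E h + 2 * h + 1)) \<or>
      (2 * h + 1 \<le> 4 * x - 1 \<and> (n = O' h \<or> n = O' h + (2 * h + 1) + 1))"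
    proof cases
      case 1
      with n assms show ?thesis
        by (intro exI[of _ "2 * x - 1 - n"] disjI1 conjI disjI1) (auto simp: E_def)
    next
      case 2
      with n assms show ?thesis
        by (intro exI[of _ "2 * x - 1"] disjI1 conjI disjI1) (auto simp: E_def)
    next
      case 3
      with n assms show ?thesis
        by (intro exI[of _ "2 * x - 1 - n"] disjI2 conjI disjI1) (auto simp: O'_def)
    next
      case 4
      with n assms show ?thesis
        by (intro exI[of _ "2 * x - 1"] disjI2 conjI disjI1) (auto simp: O'_def)
    next
      case 5
      with n assms show ?thesis
        by (intro exI[of _ "n - 2 * x - 1"] disjI2 conjI disjI2) (auto simp: O'_def)
    next
      case 6
      with n assms show ?thesis
        by (intro exI[of _ "n - 2 * x"] disjI1 conjI disjI2) (auto simp: E_def)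
    next
      case 7
      with n assms show ?thesis
        by (intro exI[of _ "x - 1"] disjI2 conjI disjI1) (auto simp: O'_def)
    next
      case 8
      with n assms show ?thesis
        by (intro exI[of _ "6 * x - 2 - n"] disjI2 conjI disjI1) (auto simp: O'_def)
    next
      case 9
      with n assms show ?thesis
        by (intro exI[of _ "2 * x - 1"] disjI1 conjI disjI2) (auto simp: E_def y)
    next
      case 10
      with n assms show ?thesis
        by (intro exI[of _ "6 * x - 1 - n"] disjI1 conjI disjI1) (auto simp: E_def)
    next
      case 11
      with n assms show ?thesis
        by (intro exI[of _ "x - 1"] disjI2 conjI disjI2) (auto simp: O'_def)
    next
      case 12
      with n assms show ?thesis
        by (intro exI[of _ "2 * x - 1"] disjI2 conjI disjI2) (auto simp: O'_def)
    next
      case 13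
      with n assms show ?thesis
        by (intro exI[of _ "n - 6 * x"] disjI1 conjI disjI2) (auto simp: E_def)
    next
      case 14
      with n assms show ?thesis
        by (intro exI[of _ "n - 6 * x"] disjI2 conjI disjI2) (auto simp: O'_def)
    qed
  qed
qed

section \<open>Zero-sum columns\<close>

text \<open>As for \<^const>\<open>covering_pairs\<close>, covering all absolute values \<open>1, \<dots>, mt\<close> with \<open>mt\<close> entries already
  makes each of them occur exactly once.\<close>

definition zero_sum_columns :: "nat \<Rightarrow> nat \<Rightarrow> (nat \<Rightarrow> int list) \<Rightarrow> bool" where
  "zero_sum_columns m t c \<longleftrightarrow>
     (\<forall>j<m. length (c j) = t \<and> sum_list (c j) = 0) \<and>
     (\<forall>n\<in>{1..m * t}. \<exists>j<m. \<exists>x\<in>set (c j). \<bar>x\<bar> = int n)"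

lemma zero_sum_columnsI:
  assumes "\<And>j. j < m \<Longrightarrow> length (c j) = t"
    and "\<And>j. j < m \<Longrightarrow> sum_list (c j) = 0"
    and "\<And>n. 1 \<le> n \<Longrightarrow> n \<le> m * t \<Longrightarrow> \<exists>j<m. \<exists>x\<in>set (c j). \<bar>x\<bar> = int n"
  shows "zero_sum_columns m t c"
  using assms by (simp add: zero_sum_columns_def)

lemma zero_sum_columns_add_4:
  assumes c: "zero_sum_columns m t c"
  shows "\<exists>c'. zero_sum_columns m (t + 4) c'"
proof -
  define b where "b j = int (m * t + 4 * j)" for j
  define c' where "c' j = c j @ [b j + 1, - (b j + 2), - (b j + 3), b j + 4]" for j
  have "zero_sum_columns m (t + 4) c'"
  proof (rule zero_sum_columnsI)
    fix n assume n: "1 \<le> n" "n \<le> m * (t + 4)"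
    show "\<exists>j<m. \<exists>x\<in>set (c' j). \<bar>x\<bar> = int n"
    proof (cases "n \<le> m * t")
      case True
      with c n(1) obtain j x where "j < m" "x \<in> set (c j)" "\<bar>x\<bar> = int n"
        by (force simp: zero_sum_columns_def)
      then show ?thesis by (auto simp: c'_def)
    next
      case False
      define j where "j = (n - 1 - m * t) div 4"
      define r where "r = (n - 1 - m * t) mod 4"
      have "n - 1 - m * t = 4 * j + r" unfolding j_def r_def by simp
      with False have nj: "n = m * t + 4 * j + r + 1" by linarith
      have nb: "int n = b j + int r + 1" "0 \<le> b j"
        by (simp_all add: nj b_def)
      have "j < m" using n(2) nj by (simp add: algebra_simps)
      moreover have "r < 4" by (simp add: r_def)
      then have "r = 0 \<or> r = 1 \<or> r = 2 \<or> r = 3" by linarith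
      then have "\<exists>x\<in>set (c' j). \<bar>x\<bar> = int n"
        using nb by (elim disjE) (simp_all add: c'_def abs_if)
      ultimately show ?thesis by blast
    qed
  qed (use c in \<open>auto simp: zero_sum_columns_def c'_def\<close>)
  then show ?thesis by blast
qed

lemma zero_sum_columns_add_mult_4:
  assumes "\<exists>c. zero_sum_columns m t c"
  shows "\<exists>c. zero_sum_columns m (t + 4 * q) c"
proof (induction q)
  case 0
  then show ?case using assms by simp
next
  case (Suc q)
  then show ?case
    using zero_sum_columns_add_4[of m "t + 4 * q"] by (auto simp: algebra_simps)
qed

section \<open>Base cases of column length 0, 3, 5 and 6\<close>

lemma zero_sum_columns_0: "zero_sum_columns m 0 (\<lambda>_. [])"
  by (simp add: zero_sum_columns_def)

lemma zero_sum_columns_3: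
  assumes a: "covering_pairs 0 m a"
  shows "\<exists>c. zero_sum_columns m 3 c"
proof -
  define c where "c j = [int (j + 1), int (m + a (j + 1)), - int (m + a (j + 1) + (j + 1))]" for j
  have "zero_sum_columns m 3 c"
  proof (rule zero_sum_columnsI)
    fix n assume n: "1 \<le> n" "n \<le> m * 3"
    show "\<exists>j<m. \<exists>x\<in>set (c j). \<bar>x\<bar> = int n"
    proof (cases "n \<le> m")
      case True
      with n(1) show ?thesis by (intro exI[of _ "n - 1"]) (simp add: c_def)
    next
      case False
      with n have "n - m \<in> {1..2 * m}"
        unfolding atLeastAtMost_iff by linarith
      with a obtain d where d: "d \<in> {1..m}" "n - m = a d \<or> n - m = a d + d + 0"
        unfolding covering_pairs_def by blast
      with False show ?thesis by (intro exI[of _ "d - 1"]) (auto simp: c_def)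
    qed
  qed (simp_all add: c_def)
  then show ?thesis by blast
qed

lemma zero_sum_columns_5:
  assumes a: "covering_pairs 1 m a"
  shows "\<exists>c. zero_sum_columns m 5 c"
proof -
  \<comment> \<open>The three ranges \<open>1..m\<close>, \<open>m + 1..3 * m\<close> and
    \<open>3 * m + 1..5 * m\<close> are filled by the values of d, the shifted Langford pairs and
    the final consecutive pairs.\<close>
  define c where "c j = [int (j + 1), int (m + a (j + 1)), - int (m + a (j + 1) + (j + 1) + 1),
    - int (3 * m + 2 * j + 1), int (3 * m + 2 * j + 2)]" for j
  have "zero_sum_columns m 5 c"
  proof (rule zero_sum_columnsI)
    fix n assume n: "1 \<le> n" "n \<le> m * 5"
    consider "n \<le> m" | "m < n" "n \<le> 3 * m" | "3 * m < n" by linarith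
    then show "\<exists>j<m. \<exists>x\<in>set (c j). \<bar>x\<bar> = int n"
    proof cases
      case 1
      with n(1) show ?thesis by (intro exI[of _ "n - 1"]) (simp add: c_def)
    next
      case 2
      then have "n - m \<in> {1..2 * m}"
        unfolding atLeastAtMost_iff by linarith
      with a obtain d where "d \<in> {1..m}" "n - m = a d \<or> n - m = a d + d + 1"
        unfolding covering_pairs_def by blast
      with 2 show ?thesis by (intro exI[of _ "d - 1"]) (auto simp: c_def)
    next
      case 3
      define j where "j = (n - 1 - 3 * m) div 2"
      have "n = 3 * m + 2 * j + 1 \<or> n = 3 * m + 2 * j + 2"
        unfolding j_def using 3 by presburger
      then show ?thesis using n(2) by (intro exI[of _ j]) (auto simp: c_def)
    qed
  qed (simp_all add: c_def)
  then show ?thesis by blast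
qed

text \<open>Six consecutive numbers have an odd sum and admit no signs with sum zero, so columns are
  treated in twos. In each column three signs are positive and three negative, so the offset
  \<open>b\<close> cancels.\<close>

lemma zero_sum_columns_6:
  assumes "even m"
  shows "\<exists>c. zero_sum_columns m 6 c"
proof -
  define c where "c j = (if even j
      then let b = 6 * int j in [b + 1, b + 3, b + 7, - (b + 2), - (b + 4), - (b + 5)]
      else let b = 6 * int (j - 1) in [b + 6, b + 10, b + 12, - (b + 8), - (b + 9), - (b + 11)])" for j
  have "zero_sum_columns m 6 c"
  proof (rule zero_sum_columnsI)
    fix n assume n: "1 \<le> n" "n \<le> m * 6"
    define q where "q = (n - 1) div 12"
    define r where "r = (n - 1) mod 12"
    have "n - 1 = 12 * q + r" unfolding q_def r_def by simp
    with n have nq: "n = 12 * q + r + 1" by linarith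
    have q: "2 * q + 1 < m"
    proof -
      obtain p where "m = 2 * p" using assms by (elim evenE)
      moreover from this n(2) nq have "q < p" by linarith
      ultimately show ?thesis by linarith
    qed
    \<comment> \<open>The two sets are the offsets, lowered by one, of the absolute values in the
      even and the odd column.\<close>
    have "\<forall>r\<in>{..<12::nat}. r \<in> {0, 1, 2, 3, 4, 6} \<or> r \<in> {5, 7, 8, 9, 10, 11}"
      by code_simp
    moreover have "r \<in> {..<12}" by (simp add: r_def)
    ultimately have "r \<in> {0, 1, 2, 3, 4, 6} \<or> r \<in> {5, 7, 8, 9, 10, 11}" by blast
    then show "\<exists>j<m. \<exists>x\<in>set (c j). \<bar>x\<bar> = int n"
    proof
      assume "r \<in> {0, 1, 2, 3, 4, 6}"
      then show ?thesis
        using q by (intro exI[of _ "2 * q"]) (auto simp: c_def nq Let_def)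
    next
      assume "r \<in> {5, 7, 8, 9, 10, 11}"
      then show ?thesis
        using q by (intro exI[of _ "2 * q + 1"]) (auto simp: c_def nq Let_def)
    qed
  qed (simp_all add: c_def Let_def)
  then show ?thesis by blast
qed

text \<open>The condition on \<open>m * t\<close> becomes one on m for each residue of t modulo 4:
  none for 0, \<open>m mod 4\<close> in {0, 3} for 1, m even for 2, and \<open>m mod 4\<close> in
  {0, 1} for 3. These match the orders of the Langford and Skolem sequences above.\<close>

lemma zero_sum_columns_exist:
  assumes "m \<ge> 3" "t \<ge> 3" "m * t mod 4 = 0 \<or> m * t mod 4 = 3"
  shows "\<exists>c. zero_sum_columns m t c"
proof -
  define q where "q = t div 4"
  have mt: "m * t mod 4 = (m mod 4) * (t mod 4) mod 4"
    by (simp add: mod_mult_eq)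
  have "t mod 4 < 4" "m mod 4 < 4" by simp_all
  then consider "t mod 4 = 0" | "t mod 4 = 1" | "t mod 4 = 2" | "t mod 4 = 3"
    by linarith
  then show ?thesis
  proof cases
    case 1
    then have t: "t = 0 + 4 * q" unfolding q_def by presburger
    show ?thesis
      unfolding t using zero_sum_columns_0 by (intro zero_sum_columns_add_mult_4) blast
  next
    case 2
    \<comment> \<open>As \<open>t \<ge> 3\<close>, the residue 1 forces \<open>t \<ge> 5\<close>, so
      \<open>q - 1\<close> is not truncated.\<close>
    with assms(2) have t: "t = 5 + 4 * (q - 1)" unfolding q_def by presburger
    from 2 mt assms(3) have "m mod 4 = 0 \<or> m mod 4 = 3" by simp
    then have "\<exists>a. covering_pairs 1 m a"
    proof
      assume "m mod 4 = 0"
      then show ?thesis using langford_pairs_mod_0[of "m div 4"] assms(1) by auto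
    next
      assume "m mod 4 = 3"
      then have "m = 4 * (m div 4 + 1) - 1" by presburger
      then show ?thesis using langford_pairs_mod_3[of "m div 4 + 1"] by simp
    qed
    then show ?thesis
      unfolding t using zero_sum_columns_5 by (intro zero_sum_columns_add_mult_4) blast
  next
    case 3
    with assms(2) have t: "t = 6 + 4 * (q - 1)" unfolding q_def by presburger
    have "even m"
    proof (rule ccontr)
      assume "odd m"
      then have "m mod 4 = 1 \<or> m mod 4 = 3" by presburger
      with 3 mt assms(3) show False by auto
    qed
    then show ?thesis
      unfolding t by (intro zero_sum_columns_add_mult_4 zero_sum_columns_6)
  next
    case 4
    then have t: "t = 3 + 4 * q" unfolding q_def by presburger
    from \<open>m mod 4 < 4\<close> have "m mod 4 = 0 \<or> m mod 4 = 1 \<or> m mod 4 = 2 \<or> m mod 4 = 3" by linarith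
    with 4 mt assms(3) have "m mod 4 = 0 \<or> m mod 4 = 1" by auto
    then have "\<exists>a. covering_pairs 0 m a"
    proof
      assume "m mod 4 = 0"
      then show ?thesis using skolem_pairs_mod_0[of "m div 4"] assms(1) by auto
    next
      assume "m mod 4 = 1"
      then have "m = 4 * (m div 4) + 1" by presburger
      moreover from this assms(1) have "m div 4 \<ge> 1" by linarith
      ultimately show ?thesis using skolem_pairs_mod_1[of "m div 4"] by simp
    qed
    then show ?thesis
      unfolding t using zero_sum_columns_3 by (intro zero_sum_columns_add_mult_4) blast
  qed
qed

section \<open>From columns to the array\<close>

text \<open>The residue \<open>(i + j) mod m\<close> tells which list entry of column j lands in row
  i, and the inverse adds the negative of j modulo m. Since \<open>i + j\<close> is symmetric, this
  also counts the filled cells of a row.\<close>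

lemma bij_betw_rotate:
  fixes m t j :: nat
  assumes "0 < m" "t \<le> m"
  shows "bij_betw (\<lambda>i. (i + j) mod m) {i. i < m \<and> (i + j) mod m < t} {..<t}"
proof (rule bij_betw_byWitness[where f' = "\<lambda>k. (k + (m - j mod m)) mod m"])
  have j: "j mod m < m" using assms(1) by simp
  have l: "((i + j) mod m + (m - j mod m)) mod m = i" if "i < m" for i
  proof -
    have "((i + j) mod m + (m - j mod m)) mod m = (i + j mod m + (m - j mod m)) mod m"
      by (metis mod_add_left_eq mod_add_right_eq)
    also have "i + j mod m + (m - j mod m) = i + m" using j by simp
    finally show ?thesis using that by simp
  qed
  have r: "((k + (m - j mod m)) mod m + j) mod m = k" if "k < m" for k
  proof -
    have "((k + (m - j mod m)) mod m + j) mod m = (k + (m - j mod m) + j mod m) mod m"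
      by (metis mod_add_left_eq mod_add_right_eq)
    also have "k + (m - j mod m) + j mod m = k + m" using j by simp
    finally show ?thesis using that by simp
  qed
  show "\<forall>i\<in>{i. i < m \<and> (i + j) mod m < t}. ((i + j) mod m + (m - j mod m)) mod m = i"
    using l by simp
  show "\<forall>k\<in>{..<t}. ((k + (m - j mod m)) mod m + j) mod m = k"
    using r assms by simp
  then show "(\<lambda>k. (k + (m - j mod m)) mod m) ` {..<t} \<subseteq> {i. i < m \<and> (i + j) mod m < t}"
    using assms by auto
qed auto

lemma signed_magic_array_if_zero_sum_columns:
  assumes t: "0 < t" "t \<le> m" and c: "zero_sum_columns m t c"
  shows "\<exists>A. signed_magic_array m (2 * m) (2 * t) t A"
proof -
  have m: "0 < m" using t by simp
  \<comment> \<open>Replacing j by \<open>j + m\<close> keeps \<open>(i + j) mod m\<close>, so the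
    right half has the shape of the left one, with opposite entries.\<close>
  define A where "A i j = (if (i + j) mod m < t
    then Some (if j < m then c j ! ((i + j) mod m) else - (c (j - m) ! ((i + j) mod m)))
    else None)" for i j
  define X where "X = sma_entries m (2 * t)"
  define R where "R i = {j. j < m \<and> (i + j) mod m < t}" for i
  define F where "F = (SIGMA i:{..<m}. {j. j < 2 * m \<and> A i j \<noteq> None})"
  define entry where "entry = (\<lambda>(i, j). the (A i j))"
  have A_None: "A i j \<noteq> None \<longleftrightarrow> (i + j) mod m < t" for i j by (simp add: A_def)
  have X: "X = {- int (m * t)..int (m * t)} - {0}"
    by (simp add: X_def sma_entries_def zdiv_int[symmetric])
  have R: "finite (R i)" "card (R i) = t" for i
    using bij_betw_same_card[OF bij_betw_rotate[OF m t(2), of i]]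
    by (simp_all add: R_def add.commute)
  have row: "{j. j < 2 * m \<and> A i j \<noteq> None} = R i \<union> (\<lambda>j. j + m) ` R i" for i
  proof -
    have in_image: "j \<in> (\<lambda>j. j + m) ` R i \<longleftrightarrow> m \<le> j \<and> j < 2 * m \<and> (i + j) mod m < t" for j
    proof
      assume r: "m \<le> j \<and> j < 2 * m \<and> (i + j) mod m < t"
      then have "(i + (j - m)) mod m = (i + j) mod m"
        by (metis Nat.add_diff_assoc mod_add_self2 le_add_diff_inverse2 add.assoc)
      with r show "j \<in> (\<lambda>j. j + m) ` R i"
        by (intro image_eqI[of _ _ "j - m"]) (auto simp: R_def)
    qed (auto simp: R_def add.assoc[symmetric])
    show ?thesis
      unfolding A_None set_eq_iff Un_iff in_image unfolding R_def by auto
  qed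
  have disj: "R i \<inter> (\<lambda>j. j + m) ` R i = {}" for i by (auto simp: R_def)
  have card_row: "card {j. j < 2 * m \<and> A i j \<noteq> None} = 2 * t" for i
    unfolding row using R disj[of i] by (simp add: card_Un_disjoint card_image)
  have sum_row: "(\<Sum>j | j < 2 * m \<and> A i j \<noteq> None. the (A i j)) = 0" for i
  proof -
    have "the (A i (j + m)) = - the (A i j)" if "j \<in> R i" for j
      using that by (simp add: A_def R_def add.assoc[symmetric])
    then have "(\<Sum>j\<in>(\<lambda>j. j + m) ` R i. the (A i j)) = - (\<Sum>j\<in>R i. the (A i j))"
      by (simp add: sum.reindex sum_negf)
    then show ?thesis
      unfolding row using R disj[of i] by (simp add: sum.union_disjoint)
  qed
  have sum_col: "(\<Sum>i | i < m \<and> A i j \<noteq> None. the (A i j)) = 0" if "j < 2 * m" for j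
  proof -
    \<comment> \<open>\<open>f\<close> lists column j by position in the list, so that the sum over
      rows can be reindexed by the rotation.\<close>
    define f where "f k = (if j < m then c j ! k else - (c (j - m) ! k))" for k
    have sum_c: "(\<Sum>k<t. c j ! k) = 0" if "j < m" for j
      using c that by (auto simp: zero_sum_columns_def sum_list_sum_nth atLeast0LessThan)
    have "(\<Sum>i | i < m \<and> A i j \<noteq> None. the (A i j)) =
        (\<Sum>i | i < m \<and> (i + j) mod m < t. f ((i + j) mod m))"
      by (intro sum.cong) (auto simp: A_def f_def)
    also have "\<dots> = (\<Sum>k<t. f k)"
      by (rule sum.reindex_bij_betw[OF bij_betw_rotate[OF m t(2)]])
    also have "\<dots> = 0"
      using sum_c[of j] sum_c[of "j - m"] that by (cases "j < m") (auto simp: f_def sum_negf)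
    finally show ?thesis .
  qed
  have card_col: "card {i. i < m \<and> A i j \<noteq> None} = t" for j
    using bij_betw_same_card[OF bij_betw_rotate[OF m t(2), of j]] unfolding A_None by simp
  \<comment> \<open>There are as many filled cells as elements of \<open>X\<close>. Once every
    element of \<open>X\<close> is shown to occur, counting yields both that no other entry occurs
    and that none is repeated.\<close>
  have "finite F" by (auto simp: F_def)
  have "card F = (\<Sum>i<m. card {j. j < 2 * m \<and> A i j \<noteq> None})"
    unfolding F_def by (rule card_SigmaI) simp_all
  then have "card F = m * (2 * t)" unfolding card_row by simp
  moreover have "card X = 2 * (m * t)"
    unfolding X by (subst card_Diff_singleton) (auto simp: nat_add_distrib nat_mult_distrib)
  ultimately have card_F: "card F = card X" by simp
  have X_subset: "X \<subseteq> entry ` F"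
  proof
    fix x assume x: "x \<in> X"
    then have "nat \<bar>x\<bar> \<in> {1..m * t}"
      by (auto simp: X nat_le_iff simp flip: of_nat_mult)
    with c obtain j y where j: "j < m" "y \<in> set (c j)" "\<bar>y\<bar> = \<bar>x\<bar>"
      unfolding zero_sum_columns_def by fastforce
    moreover have "length (c j) = t" using c j(1) by (simp add: zero_sum_columns_def)
    ultimately obtain k where k: "k < t" "c j ! k = y" by (metis in_set_conv_nth)
    have "k \<in> (\<lambda>i. (i + j) mod m) ` {i. i < m \<and> (i + j) mod m < t}"
      using bij_betw_rotate[OF m t(2), of j] k(1) by (simp add: bij_betw_def)
    then obtain i where i: "i < m" "(i + j) mod m = k" by auto
    \<comment> \<open>If the column holds x itself, the left half provides the cell; if it holds
      \<open>- x\<close>, the right half does.\<close>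
    have "y = x \<or> - y = x" using j(3) by linarith
    then show "x \<in> entry ` F"
    proof
      assume "y = x"
      then show ?thesis using i j k
        by (intro image_eqI[of _ _ "(i, j)"]) (auto simp: F_def entry_def A_def)
    next
      assume "- y = x"
      then show ?thesis using i j k
        by (intro image_eqI[of _ _ "(i, j + m)"])
          (auto simp: F_def entry_def A_def add.assoc[symmetric])
    qed
  qed
  have "card (entry ` F) \<le> card X" using card_image_le[OF \<open>finite F\<close>] card_F by simp
  with X_subset have img: "entry ` F = X"
    using \<open>finite F\<close> by (intro card_seteq[symmetric]) auto
  then have inj: "inj_on entry F" using \<open>finite F\<close> card_F by (intro eq_card_imp_inj_on) simp_all
  have F: "(i, j) \<in> F \<longleftrightarrow> i < m \<and> j < 2 * m \<and> A i j \<noteq> None" for i j by (simp add: F_def)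
  have entries: "x \<in> X" if "i < m" "j < 2 * m" "A i j = Some x" for i j x
  proof -
    have "(i, j) \<in> F" "entry (i, j) = x" using that by (simp_all add: F entry_def)
    with img show ?thesis by blast
  qed
  have once: "\<exists>!(i, j). i < m \<and> j < 2 * m \<and> A i j = Some x" if "x \<in> X" for x
  proof -
    \<comment> \<open>The pair pattern under the unique existence quantifier abbreviates a case
      expression on one variable p.\<close>
    have eq: "(case p of (i, j) \<Rightarrow> i < m \<and> j < 2 * m \<and> A i j = Some x) \<longleftrightarrow> p \<in> F \<and> entry p = x" for p
      by (cases p) (auto simp: F entry_def)
    have "\<exists>!p. p \<in> F \<and> entry p = x"
      using that img inj by (auto simp: inj_on_def)
    then show ?thesis unfolding eq .
  qed
  have "signed_magic_array m (2 * m) (2 * t) t A"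
    unfolding signed_magic_array_def X_def[symmetric]
    using m t card_row card_col sum_row sum_col entries once by simp
  then show ?thesis by blast
qed

theorem theorem11:
  fixes m t :: nat
  assumes "m \<ge> t" and "t \<ge> 3"
    and "m * t mod 4 = 0 \<or> m * t mod 4 = 3"
  shows "\<exists>A. signed_magic_array m (2 * m) (2 * t) t A"
proof -
  obtain c where "zero_sum_columns m t c"
    using zero_sum_columns_exist[of m t] assms by auto
  then show ?thesis
    using assms by (intro signed_magic_array_if_zero_sum_columns) simp_all
qed

end
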